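(* Let $2\le s<d$. Define the selector $\eta^{**}=(\eta^{**}_1,\dots,\eta^{**}_d)$ by $$\eta^{**}_{j} = \mathbf{1}\Big\{ f_{1}(X_{j})\, G_1(X_i: i\ne j)\geq f_{0}(X_{j})\, G_0(X_i: i\ne j)\Big\},\qquad j=1,\dots,d,$$ where $$G_1(X_i: i\ne j) = \sum_{\substack{S\subset\{1,\dots,d\}\setminus\{j\}\\ |S|=s-1}}\ \prod_{k \in S}f_{1}(X_{k})\prod_{k \notin S,\,k\ne j}f_{0}(X_{k}),$$ $$G_0(X_i: i\ne j) =\sum_{\substack{S\subset\{1,\dots,d\}\setminus\{j\}\\ |S|=s}}\ \prod_{k \in S}f_{1}(X_{k})\prod_{k \notin S,\,k\ne j}f_{0}(X_{k}).$$ Let $\pi$ be the uniform distribution on $\{\eta\in\{0,1\}^d:|\eta|_0=s\}$ and let $\mathbb{E}_\pi$ denote the expectation over $\eta\sim\pi$. Then $\eta^{**}$ is minimax on $\{|\eta|_0=s\}$ and Bayes with respect to $\pi$: $$\inf_{\tilde{\eta}} \sup_{|\eta|_{0} = s} \mathbf{E}_{\eta} |\tilde{\eta} - \eta| = \sup_{|\eta|_{0} = s}\mathbf{E}_{\eta} |\eta^{**} - \eta| = \mathbf{E}_{e(s)} |\eta^{**} - e(s)|,$$ $$\inf_{\tilde{\eta}} \ \mathbb{E}_{\pi} \mathbf{E}_{\eta} |\tilde{\eta} - \eta| = \mathbb{E}_{\pi}\mathbf{E}_{\eta} |\eta^{**} - \eta| = \mathbf{E}_{e(s)} |\eta^{**}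 - e(s)|,$$ where $\inf_{\tilde\eta}$ is the infimum over all selectors and $e(s)=(1,\dots,1,0,\dots,0)$ is the vector with $s$ ones followed by $d-s$ zeros.
   Context: Pivotal selection problem: $d>2$ and $1\le s<d$ are integers; $P_0\neq P_1$ are probability measures on a measurable space $(\mathcal X,\mathcal U)$ with densities $f_0,f_1$ with respect to a common dominating measure $\mu$. For $\eta\in\{0,1\}^d$, under $\mathbf{P}_\eta$ the observations $X_1,\dots,X_d$ are independent, with $X_j\sim P_1$ if $\eta_j=1$ and $X_j\sim P_0$ if $\eta_j=0$; $\mathbf{E}_\eta$ is the corresponding expectation. A selector is any measurable function $\tilde\eta=\tilde\eta(X_1,\dots,X_d,\zeta)$ with values in $\{0,1\}^d$, where $\zeta$ is a randomization variable with values in some measurable space, independent of $(X_1,\dots,X_d)$. $|\tilde\eta-\eta|=\sum_{j=1}^d\mathbf{1}(\tilde\eta_j\ne\eta_j)$ is the Hamming loss; $|\eta|_0$ is the number of non-zero components of $\eta$; $\sup_{|\eta|_0=s}$ is over $\eta\in\{0,1\}^d$ with $|\eta|_0=s$. *)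

theory Defs
  imports "HOL-Probability.Probability"
begin

definition cube :: "nat \<Rightarrow> (nat \<Rightarrow> nat) set" where
  "cube d = {1..d} \<rightarrow>\<^sub>E {0, 1}"

definition norm0 :: "nat \<Rightarrow> (nat \<Rightarrow> nat) \<Rightarrow> nat" where
  "norm0 d \<eta> = card {j \<in> {1..d}. \<eta> j \<noteq> 0}"

definition sparse_vecs :: "nat \<Rightarrow> nat \<Rightarrow> (nat \<Rightarrow> nat) set" where
  "sparse_vecs d s = {\<eta> \<in> cube d. norm0 d \<eta> = s}"

definition e_vec :: "nat \<Rightarrow> nat \<Rightarrow> (nat \<Rightarrow> nat)" where
  "e_vec d s = (\<lambda>j\<in>{1..d}. if j \<le> s then 1 else 0)"

definition hamming :: "nat \<Rightarrow> (nat \<Rightarrow> nat) \<Rightarrow> (nat \<Rightarrow> nat) \<Rightarrow> real" where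
  "hamming d \<theta> \<eta> = (\<Sum>j=1..d. if \<theta> j \<noteq> \<eta> j then 1 else 0)"

text \<open>The joint law of the independent observations under the parameter \<open>\<eta>\<close>.\<close>

definition obs_law :: "'a measure \<Rightarrow> 'a measure \<Rightarrow> nat \<Rightarrow> (nat \<Rightarrow> nat) \<Rightarrow> (nat \<Rightarrow> 'a) measure" where
  "obs_law P0 P1 d \<eta> = (\<Pi>\<^sub>M j\<in>{1..d}. if \<eta> j = 1 then P1 else P0)"

text \<open>
  A selector is a pair \<open>(R, T)\<close>: \<open>R\<close> is the law of the randomization variable \<open>\<zeta>\<close>, on an
  arbitrary measurable space carried by the type \<open>'z\<close>, and \<open>T\<close> is the map
  \<open>(X, \<zeta>) \<mapsto> T (X, \<zeta>)\<close>. Of the measure \<open>U\<close> only the measurable space is used.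
  Independence of \<open>X\<close> and \<open>\<zeta>\<close> is the product measure in \<open>risk\<close>.
\<close>

definition selectors ::
    "nat \<Rightarrow> 'a measure \<Rightarrow> ('z measure \<times> ((nat \<Rightarrow> 'a) \<times> 'z \<Rightarrow> (nat \<Rightarrow> nat))) set" where
  "selectors d U = {(R, T). prob_space R \<and>
     T \<in> measurable ((\<Pi>\<^sub>M j\<in>{1..d}. U) \<Otimes>\<^sub>M R) (count_space (cube d))}"

definition risk ::
    "'a measure \<Rightarrow> 'a measure \<Rightarrow> nat \<Rightarrow> 'z measure \<Rightarrow>
     ((nat \<Rightarrow> 'a) \<times> 'z \<Rightarrow> (nat \<Rightarrow> nat)) \<Rightarrow> (nat \<Rightarrow> nat) \<Rightarrow> real" where
  "risk P0 P1 d R T \<eta> = (\<integral>\<omega>. hamming d (T \<omega>) \<eta> \<partial>(obs_law P0 P1 d \<eta> \<Otimes>\<^sub>M R))"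

text \<open>The risk of a selector that does not use the randomization variable.\<close>

definition risk_nr ::
    "'a measure \<Rightarrow> 'a measure \<Rightarrow> nat \<Rightarrow> ((nat \<Rightarrow> 'a) \<Rightarrow> (nat \<Rightarrow> nat)) \<Rightarrow> (nat \<Rightarrow> nat) \<Rightarrow> real" where
  "risk_nr P0 P1 d t \<eta> = (\<integral>x. hamming d (t x) \<eta> \<partial>(obs_law P0 P1 d \<eta>))"

text \<open>The sum over supports of size \<open>m\<close>; it is \<open>G\<^sub>1\<close> for \<open>m = s - 1\<close> and \<open>G\<^sub>0\<close> for \<open>m = s\<close>.\<close>

definition G_sum :: "('a \<Rightarrow> real) \<Rightarrow> ('a \<Rightarrow> real) \<Rightarrow> nat \<Rightarrow> nat \<Rightarrow> nat \<Rightarrow> (nat \<Rightarrow> 'a) \<Rightarrow> real" where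
  "G_sum f0 f1 d m j x =
     (\<Sum>S | S \<subseteq> {1..d} - {j} \<and> card S = m.
        (\<Prod>k\<in>S. f1 (x k)) * (\<Prod>k\<in>{1..d} - {j} - S. f0 (x k)))"

definition eta_star ::
    "('a \<Rightarrow> real) \<Rightarrow> ('a \<Rightarrow> real) \<Rightarrow> nat \<Rightarrow> nat \<Rightarrow> (nat \<Rightarrow> 'a) \<Rightarrow> (nat \<Rightarrow> nat)" where
  "eta_star f0 f1 d s x =
     (\<lambda>j\<in>{1..d}. if f1 (x j) * G_sum f0 f1 d (s - 1) j x \<ge> f0 (x j) * G_sum f0 f1 d s j x
                 then 1 else 0)"

end

theory Submission
  imports Defs
begin

text \<open>
  Averaged over the uniform prior, the risk is the integral of
  \<open>\<Sum>\<^sub>j \<Sum>\<^sub>\<eta> lik \<eta> x \<cdot> 1(T\<^sub>j \<noteq> \<eta>\<^sub>j)\<close>, and summing the likelihoods of all \<open>\<eta>\<close> with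
  \<open>\<eta>\<^sub>j = 1\<close> (resp. \<open>0\<close>) gives \<open>f\<^sub>1(x\<^sub>j) G\<^sub>1\<close> (resp. \<open>f\<^sub>0(x\<^sub>j) G\<^sub>0\<close>). So \<open>\<eta>\<^sup>*\<^sup>*\<close> minimises the integrand
  pointwise and is Bayes. It is also equivariant under permutations of the coordinates, so its
  risk is constant over the \<open>s\<close>-sparse vectors, and a Bayes rule with constant risk is minimax.
\<close>

section \<open>Likelihoods, sparse vectors and the Hamming loss\<close>

definition lik :: "('a \<Rightarrow> real) \<Rightarrow> ('a \<Rightarrow> real) \<Rightarrow> nat \<Rightarrow> (nat \<Rightarrow> nat) \<Rightarrow> (nat \<Rightarrow> 'a) \<Rightarrow> real" where
  "lik f0 f1 d \<eta> x = (\<Prod>k=1..d. if \<eta> k = 1 then f1 (x k) else f0 (x k))"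

lemma cube_cases: "\<theta> \<in> cube d \<Longrightarrow> j \<in> {1..d} \<Longrightarrow> \<theta> j = 0 \<or> \<theta> j = 1"
  by (auto simp: cube_def PiE_iff)

lemma finite_cube: "finite (cube d)"
  by (simp add: cube_def finite_PiE)

lemma finite_sparse_vecs: "finite (sparse_vecs d s)"
  by (simp add: sparse_vecs_def finite_cube)

lemma sparse_vecs_iff:
  "\<eta> \<in> sparse_vecs d s \<longleftrightarrow> \<eta> \<in> cube d \<and> card {k\<in>{1..d}. \<eta> k = 1} = s"
proof -
  have "{k\<in>{1..d}. \<eta> k \<noteq> 0} = {k\<in>{1..d}. \<eta> k = 1}" if "\<eta> \<in> cube d"
    using cube_cases[OF that] by fastforce
  then show ?thesis
    by (auto simp: sparse_vecs_def norm0_def)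
qed

lemma e_vec_in_sparse_vecs: "s \<le> d \<Longrightarrow> e_vec d s \<in> sparse_vecs d s"
proof -
  assume "s \<le> d"
  then have "{k\<in>{1..d}. e_vec d s k = 1} = {1..s}"
    by (auto simp: e_vec_def)
  then show ?thesis
    by (auto simp: sparse_vecs_iff cube_def e_vec_def)
qed

lemma eta_star_in_cube: "eta_star f0 f1 d s x \<in> cube d"
  by (auto simp: eta_star_def cube_def)

lemma hamming_nonneg: "0 \<le> hamming d \<theta> \<eta>"
  by (auto simp: hamming_def intro!: sum_nonneg)

lemma hamming_le: "hamming d \<theta> \<eta> \<le> real d"
proof -
  have "hamming d \<theta> \<eta> \<le> (\<Sum>j=1..d. 1)"
    unfolding hamming_def by (rule sum_mono) auto
  then show ?thesis by simp
qed

section \<open>Pointwise minimisation of the likelihood-weighted loss\<close>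

text \<open>A vector with value \<open>c\<close> at \<open>j\<close> is determined by its support
  off \<open>j\<close>, which has \<open>s - c\<close> elements, and its likelihood factors
  accordingly. Thus \<open>c\<close> is both the prescribed value and the number of ones it uses up;
  \<open>c \<le> s\<close> keeps the natural subtraction exact.\<close>

lemma sum_lik_fixed_coordinate:
  assumes "j \<in> {1..d}" and "c \<in> {0, 1}" and "c \<le> s"
  shows "(\<Sum>\<eta> | \<eta> \<in> sparse_vecs d s \<and> \<eta> j = c. lik f0 f1 d \<eta> x)
    = (if c = 1 then f1 (x j) else f0 (x j)) * G_sum f0 f1 d (s - c) j x"
proof -
  define supp where "supp \<eta> = {k\<in>{1..d} - {j}. \<eta> k = 1}" for \<eta> :: "nat \<Rightarrow> nat"
  \<comment> \<open>The inverse of \<open>supp\<close> on the vectors with value \<open>c\<close> at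
    \<open>j\<close>; restricting to \<open>{1..d}\<close> makes its values extensional, as
    membership in \<open>cube d\<close> requires.\<close>
  define vec where "vec S = (\<lambda>k\<in>{1..d}. if k = j then c else if k \<in> S then 1 else 0)" for S
  define w where "w S = (\<Prod>k\<in>S. f1 (x k)) * (\<Prod>k\<in>{1..d} - {j} - S. f0 (x k))" for S
  have card_supp: "card {k\<in>{1..d}. \<eta> k = 1} = c + card (supp \<eta>)" if "\<eta> j = c" for \<eta>
  proof (cases "c = 1")
    case True
    then have "{k\<in>{1..d}. \<eta> k = 1} = insert j (supp \<eta>)"
      using that assms by (auto simp: supp_def)
    then show ?thesis using True by (simp add: supp_def)
  next
    case False
    then have "{k\<in>{1..d}. \<eta> k = 1} = supp \<eta>"
      using that by (auto simp: supp_def)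
    then show ?thesis using False assms by simp
  qed
  have lik_eq: "lik f0 f1 d \<eta> x = (if c = 1 then f1 (x j) else f0 (x j)) * w (supp \<eta>)"
    if "\<eta> j = c" for \<eta>
  proof -
    have "lik f0 f1 d \<eta> x = (if c = 1 then f1 (x j) else f0 (x j)) *
        (\<Prod>k\<in>{1..d} - {j}. if \<eta> k = 1 then f1 (x k) else f0 (x k))"
      unfolding lik_def using assms that by (subst prod.remove[of _ j]) auto
    also have "(\<Prod>k\<in>{1..d} - {j}. if \<eta> k = 1 then f1 (x k) else f0 (x k)) = w (supp \<eta>)"
    proof -
      have "({1..d} - {j}) \<inter> {k. \<eta> k = 1} = supp \<eta>"
        and "({1..d} - {j}) \<inter> - {k. \<eta> k = 1} = {1..d} - {j} - supp \<eta>"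
        by (auto simp: supp_def)
      then show ?thesis
        by (subst prod.If_cases) (simp_all only: w_def finite_Diff finite_atLeastAtMost)
    qed
    finally show ?thesis .
  qed
  have supp_vec: "supp (vec S) = S" if "S \<subseteq> {1..d} - {j}" for S
    using that by (auto simp: supp_def vec_def)
  have vec_j: "vec S j = c" for S
    using assms by (simp add: vec_def)
  have vec_supp: "vec (supp \<eta>) = \<eta>" if "\<eta> \<in> cube d" "\<eta> j = c" for \<eta>
  proof (rule PiE_ext)
    show "vec (supp \<eta>) \<in> {1..d} \<rightarrow>\<^sub>E UNIV" "\<eta> \<in> {1..d} \<rightarrow>\<^sub>E UNIV"
      using that(1) by (auto simp: vec_def cube_def PiE_iff)
    show "vec (supp \<eta>) k = \<eta> k" if k: "k \<in> {1..d}" for k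
      using cube_cases[OF \<open>\<eta> \<in> cube d\<close> k] k \<open>\<eta> j = c\<close> by (cases "k = j") (auto simp: vec_def supp_def)
  qed
  have "(\<Sum>\<eta> | \<eta> \<in> sparse_vecs d s \<and> \<eta> j = c. lik f0 f1 d \<eta> x)
      = (\<Sum>S | S \<subseteq> {1..d} - {j} \<and> card S = s - c. (if c = 1 then f1 (x j) else f0 (x j)) * w S)"
  proof (rule sum.reindex_bij_witness[of _ vec supp])
    fix S assume S: "S \<in> {S. S \<subseteq> {1..d} - {j} \<and> card S = s - c}"
    then have "card {k\<in>{1..d}. vec S k = 1} = s"
      using assms card_supp[of "vec S"] by (simp add: vec_j supp_vec)
    moreover have "vec S \<in> cube d"
      using assms by (auto simp: vec_def cube_def)
    ultimately show "vec S \<in> {\<eta>. \<eta> \<in> sparse_vecs d s \<and> \<eta> j = c}"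
      by (simp add: sparse_vecs_iff vec_j)
    show "supp (vec S) = S"
      using S by (simp add: supp_vec)
  next
    fix \<eta> assume \<eta>: "\<eta> \<in> {\<eta>. \<eta> \<in> sparse_vecs d s \<and> \<eta> j = c}"
    then show "vec (supp \<eta>) = \<eta>"
      by (simp add: vec_supp sparse_vecs_iff)
    have "card (supp \<eta>) = s - c"
      using \<eta> card_supp[of \<eta>] by (auto simp: sparse_vecs_iff)
    then show "supp \<eta> \<in> {S. S \<subseteq> {1..d} - {j} \<and> card S = s - c}"
      by (auto simp: supp_def)
    show "(if c = 1 then f1 (x j) else f0 (x j)) * w (supp \<eta>) = lik f0 f1 d \<eta> x"
      using \<eta> by (simp add: lik_eq)
  qed
  then show ?thesis
    by (simp add: G_sum_def w_def sum_distrib_left)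
qed

text \<open>Exchanging the sums decouples the coordinates: coordinate \<open>j\<close> errs exactly
  on the vectors with \<open>\<eta> j = 1 - \<theta> j\<close>, whose total likelihood is given by
  \<open>sum_lik_fixed_coordinate\<close>. Up to normalisation this is the posterior expected
  loss.\<close>

lemma sum_lik_hamming:
  assumes "\<theta> \<in> cube d" and "1 \<le> s"
  shows "(\<Sum>\<eta>\<in>sparse_vecs d s. lik f0 f1 d \<eta> x * hamming d \<theta> \<eta>)
    = (\<Sum>j=1..d. if \<theta> j = 1 then f0 (x j) * G_sum f0 f1 d s j x
                 else f1 (x j) * G_sum f0 f1 d (s - 1) j x)"
proof -
  have "(\<Sum>\<eta>\<in>sparse_vecs d s. lik f0 f1 d \<eta> x * hamming d \<theta> \<eta>)
      = (\<Sum>j=1..d. \<Sum>\<eta>\<in>sparse_vecs d s. if \<theta> j \<noteq> \<eta> j then lik f0 f1 d \<eta> x else 0)"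
    unfolding hamming_def sum_distrib_left by (subst sum.swap) (auto intro!: sum.cong)
  also have "\<dots> = (\<Sum>j=1..d. \<Sum>\<eta> | \<eta> \<in> sparse_vecs d s \<and> \<theta> j \<noteq> \<eta> j. lik f0 f1 d \<eta> x)"
    by (simp add: sum.inter_filter finite_sparse_vecs)
  also have "\<dots> = (\<Sum>j=1..d. \<Sum>\<eta> | \<eta> \<in> sparse_vecs d s \<and> \<eta> j = 1 - \<theta> j. lik f0 f1 d \<eta> x)"
  proof -
    have "\<theta> j \<noteq> \<eta> j \<longleftrightarrow> \<eta> j = 1 - \<theta> j" if "j \<in> {1..d}" "\<eta> \<in> sparse_vecs d s" for j \<eta>
    proof -
      have "\<eta> \<in> cube d"
        using that by (simp add: sparse_vecs_iff)
      from cube_cases[OF assms(1) that(1)] cube_cases[OF this that(1)] show ?thesis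
        by (elim disjE) simp_all
    qed
    then have "{\<eta>. \<eta> \<in> sparse_vecs d s \<and> \<theta> j \<noteq> \<eta> j} = {\<eta>. \<eta> \<in> sparse_vecs d s \<and> \<eta> j = 1 - \<theta> j}"
      if "j \<in> {1..d}" for j
      using that by blast
    then show ?thesis
      by (intro sum.cong[OF refl]) (simp only:)
  qed
  also have "\<dots> = (\<Sum>j=1..d. if \<theta> j = 1 then f0 (x j) * G_sum f0 f1 d s j x
                 else f1 (x j) * G_sum f0 f1 d (s - 1) j x)"
  proof (intro sum.cong refl)
    fix j assume j: "j \<in> {1..d}"
    then show "(\<Sum>\<eta> | \<eta> \<in> sparse_vecs d s \<and> \<eta> j = 1 - \<theta> j. lik f0 f1 d \<eta> x)
      = (if \<theta> j = 1 then f0 (x j) * G_sum f0 f1 d s j x else f1 (x j) * G_sum f0 f1 d (s - 1) j x)"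
      using cube_cases[OF assms(1) j] assms(2)
      by (subst sum_lik_fixed_coordinate) auto
  qed
  finally show ?thesis .
qed

text \<open>Decisions may be chosen coordinate by coordinate, since elements of
  \<open>cube d\<close> are not bound to have \<open>s\<close> ones. In each coordinate
  \<open>eta_star\<close> takes the smaller of the two costs.\<close>

lemma eta_star_minimises:
  assumes "\<theta> \<in> cube d" and "1 \<le> s"
  shows "(\<Sum>\<eta>\<in>sparse_vecs d s. lik f0 f1 d \<eta> x * hamming d (eta_star f0 f1 d s x) \<eta>)
    \<le> (\<Sum>\<eta>\<in>sparse_vecs d s. lik f0 f1 d \<eta> x * hamming d \<theta> \<eta>)"
  unfolding sum_lik_hamming[OF assms] sum_lik_hamming[OF eta_star_in_cube assms(2)]
  by (rule sum_mono) (auto simp: eta_star_def)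

section \<open>Permutation of the coordinates\<close>

text \<open>Taking images under \<open>p\<close> is a bijection from the size-\<open>m\<close>
  subsets avoiding \<open>j\<close> to those avoiding \<open>p j\<close>, and it matches the
  summands. The restricted lambda keeps the permuted sample extensional, like all points of the
  product space.\<close>

lemma G_sum_permute:
  assumes p: "bij_betw p {1..d} {1..d}" and j: "j \<in> {1..d}"
  shows "G_sum f0 f1 d m j (\<lambda>n\<in>{1..d}. x (p n)) = G_sum f0 f1 d m (p j) x"
  unfolding G_sum_def
proof (rule sum.reindex_bij_witness[of _ "image (inv_into {1..d} p)" "image p"])
  let ?I = "{1..d}"
  have inj: "inj_on p ?I" and img: "p ` ?I = ?I"
    using p by (auto simp: bij_betw_def)
  let ?q = "inv_into ?I p"
  have inj_q: "inj_on ?q ?I"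
    using inj_on_inv_into[of ?I p ?I] img by simp
  {
    fix S assume S: "S \<in> {S. S \<subseteq> ?I - {j} \<and> card S = m}"
    then have SI: "S \<subseteq> ?I" by auto
    show "?q ` p ` S = S"
      using inv_into_image_cancel[OF inj SI] .
    have "p ` S \<subseteq> ?I - {p j}"
      using S img inj j by (auto dest: inj_onD)
    then show "p ` S \<in> {S. S \<subseteq> ?I - {p j} \<and> card S = m}"
      using S card_image[OF inj_on_subset[OF inj SI]] by simp
    have diff: "?I - {p j} - p ` S = p ` (?I - {j} - S)"
    proof -
      have "?I - {j} - S = ?I - insert j S" by auto
      then have "p ` (?I - {j} - S) = p ` ?I - p ` insert j S"
        using SI j by (simp add: inj_on_image_set_diff[OF inj])
      then show ?thesis unfolding img by auto
    qed
    have "(\<Prod>k\<in>p ` S. f1 (x k)) = (\<Prod>k\<in>S. f1 (x (p k)))"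
      by (rule prod.reindex_cong[OF inj_on_subset[OF inj SI]]) auto
    moreover have "(\<Prod>k\<in>?I - {p j} - p ` S. f0 (x k)) = (\<Prod>k\<in>?I - {j} - S. f0 (x (p k)))"
      unfolding diff by (rule prod.reindex_cong[OF inj_on_subset[OF inj]]) auto
    moreover have "(\<Prod>k\<in>S. f1 ((\<lambda>n\<in>?I. x (p n)) k)) = (\<Prod>k\<in>S. f1 (x (p k)))"
      using SI by (intro prod.cong) auto
    moreover have "(\<Prod>k\<in>?I - {j} - S. f0 ((\<lambda>n\<in>?I. x (p n)) k)) = (\<Prod>k\<in>?I - {j} - S. f0 (x (p k)))"
      by (intro prod.cong) auto
    ultimately show "(\<Prod>k\<in>p ` S. f1 (x k)) * (\<Prod>k\<in>?I - {p j} - p ` S. f0 (x k))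
      = (\<Prod>k\<in>S. f1 ((\<lambda>n\<in>?I. x (p n)) k)) * (\<Prod>k\<in>?I - {j} - S. f0 ((\<lambda>n\<in>?I. x (p n)) k))"
      by simp
  }
  fix S assume S: "S \<in> {S. S \<subseteq> ?I - {p j} \<and> card S = m}"
  then have SI: "S \<subseteq> ?I" by auto
  show "p ` ?q ` S = S"
    using image_inv_into_cancel[OF img SI] .
  have "?q ` S \<subseteq> ?I - {j}"
  proof
    fix k assume "k \<in> ?q ` S"
    then obtain l where l: "l \<in> S" "k = ?q l" by auto
    have "l \<in> p ` ?I"
      using l SI unfolding img by auto
    then have "k \<in> ?I" "p k = l"
      unfolding l by (rule inv_into_into, rule f_inv_into_f)
    then show "k \<in> ?I - {j}"
      using S l by auto
  qed
  then show "?q ` S \<in> {S. S \<subseteq> ?I - {j} \<and> card S = m}"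
    using S card_image[OF inj_on_subset[OF inj_q SI]] by simp
qed

text \<open>By \<open>G_sum_permute\<close>, the decision at \<open>j\<close> on the permuted data
  is the decision at \<open>p j\<close> on the original data, so the two losses are the same sum
  reindexed by \<open>p\<close>.\<close>

lemma hamming_eta_star_permute:
  assumes p: "bij_betw p {1..d} {1..d}" and "\<And>j. j \<in> {1..d} \<Longrightarrow> \<theta> j = \<eta> (p j)"
  shows "hamming d (eta_star f0 f1 d s (\<lambda>n\<in>{1..d}. x (p n))) \<theta> = hamming d (eta_star f0 f1 d s x) \<eta>"
proof -
  let ?t = "eta_star f0 f1 d s"
  have "?t (\<lambda>n\<in>{1..d}. x (p n)) j = ?t x (p j)" if "j \<in> {1..d}" for j
    using that bij_betwE[OF p] by (simp add: eta_star_def G_sum_permute[OF p that] del: atLeastAtMost_iff One_nat_def)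
  then have "hamming d (?t (\<lambda>n\<in>{1..d}. x (p n))) \<theta> = (\<Sum>j=1..d. if ?t x (p j) \<noteq> \<eta> (p j) then 1 else 0)"
    using assms(2) by (simp add: hamming_def)
  also have "\<dots> = hamming d (?t x) \<eta>"
    unfolding hamming_def by (rule sum.reindex_bij_betw[OF p])
  finally show ?thesis .
qed

text \<open>The supports have equal size, hence so do their complements; gluing a bijection between
  the supports to one between the complements gives \<open>p\<close>. So permutations act
  transitively on the sparse vectors.\<close>

lemma sparse_vecs_permutation:
  assumes "\<eta> \<in> sparse_vecs d s" and "\<theta> \<in> sparse_vecs d s"
  obtains p where "bij_betw p {1..d} {1..d}" and "\<And>j. j \<in> {1..d} \<Longrightarrow> \<theta> j = \<eta> (p j)"
proof -
  define A where "A \<eta> = {k\<in>{1..d}. \<eta> k = 1}" for \<eta> :: "nat \<Rightarrow> nat"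
  have A: "finite (A \<xi>)" "A \<xi> \<subseteq> {1..d}" for \<xi>
    by (auto simp: A_def)
  have "card (A \<theta>) = card (A \<eta>)"
    using assms by (simp add: sparse_vecs_iff A_def)
  moreover from this have "card ({1..d} - A \<theta>) = card ({1..d} - A \<eta>)"
    by (simp only: card_Diff_subset[OF A])
  ultimately obtain g h where gh: "bij_betw g (A \<theta>) (A \<eta>)" "bij_betw h ({1..d} - A \<theta>) ({1..d} - A \<eta>)"
    using A finite_same_card_bij[of "A \<theta>" "A \<eta>"]
      finite_same_card_bij[of "{1..d} - A \<theta>" "{1..d} - A \<eta>"] by auto
  define p where "p k = (if k \<in> A \<theta> then g k else h k)" for k
  have "bij_betw p (A \<theta>) (A \<eta>)"
    using gh(1) by (rule bij_betw_cong[THEN iffD1, rotated]) (simp add: p_def)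
  moreover have "bij_betw p ({1..d} - A \<theta>) ({1..d} - A \<eta>)"
    using gh(2) by (rule bij_betw_cong[THEN iffD1, rotated]) (simp add: p_def)
  ultimately have bij: "bij_betw p (A \<theta> \<union> ({1..d} - A \<theta>)) (A \<eta> \<union> ({1..d} - A \<eta>))"
    and maps: "\<And>j. j \<in> A \<theta> \<Longrightarrow> p j \<in> A \<eta>" "\<And>j. j \<in> {1..d} - A \<theta> \<Longrightarrow> p j \<in> {1..d} - A \<eta>"
    by (auto intro!: bij_betw_combine dest: bij_betwE simp del: Un_Diff_cancel)
  show thesis
  proof
    show "bij_betw p {1..d} {1..d}"
      using bij A(2) by (simp add: Un_absorb1)
    show "\<theta> j = \<eta> (p j)" if "j \<in> {1..d}" for j
    proof (cases "j \<in> A \<theta>")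
      case True
      then show ?thesis using maps(1)[of j] by (simp add: A_def)
    next
      case False
      then have pj: "p j \<in> {1..d}" "\<eta> (p j) \<noteq> 1" "\<theta> j \<noteq> 1"
        using maps(2)[of j] that by (auto simp: A_def)
      then show ?thesis
        using cube_cases[of \<theta> d j] cube_cases[of \<eta> d "p j"] assms that
        by (auto simp: sparse_vecs_iff)
    qed
  qed
qed

section \<open>Common dominating measures and product densities\<close>

text \<open>
  The dominating measure of the problem need not be \<open>\<sigma>\<close>-finite, so its product may be degenerate;
  reweighting by \<open>1/(f + g)\<close> restricts it to the \<open>\<sigma>\<close>-finite set where \<open>f + g > 0\<close>.
\<close>

lemma sigma_finite_dominating_measure:
  fixes f g :: "'a \<Rightarrow> real"
  assumes [measurable]: "f \<in> borel_measurable M" "g \<in> borel_measurable M"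
    and nonneg: "\<And>x. x \<in> space M \<Longrightarrow> 0 \<le> f x" "\<And>x. x \<in> space M \<Longrightarrow> 0 \<le> g x"
    and fin: "finite_measure (density M f)" "finite_measure (density M g)"
  obtains N where "sigma_finite_measure N" and "sets N = sets M"
    and "density N f = density M f" and "density N g = density M g"
proof -
  define h where "h x = f x + g x" for x
  have [measurable]: "h \<in> borel_measurable M"
    unfolding h_def by measurable
  define L where "L = density M h"
  have [simp]: "sets L = sets M" by (simp add: L_def)
  have [measurable]: "(\<lambda>x. ennreal (1 / h x)) \<in> borel_measurable L"
    unfolding L_def by simp
  have "emeasure L (space L) = (\<integral>\<^sup>+x. ennreal (f x) + ennreal (g x) \<partial>M)"
    unfolding L_def by (simp add: emeasure_density h_def nonneg cong: nn_integral_cong)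
  also have "\<dots> = emeasure (density M f) (space M) + emeasure (density M g) (space M)"
    by (simp add: nn_integral_add emeasure_density cong: nn_integral_cong)
  also have "\<dots> \<noteq> \<infinity>"
    using fin[THEN finite_measure.emeasure_finite] by (simp add: top_unique)
  finally interpret L: finite_measure L
    by (rule finite_measureI)
  \<comment> \<open>As \<open>1 / h x\<close> is 0 where \<open>h x = 0\<close>, \<open>N\<close>
    agrees with \<open>M\<close> on the set where \<open>h\<close> is positive and gives measure
    zero to the rest.\<close>
  define N where "N = density L (\<lambda>x. ennreal (1 / h x))"
  \<comment> \<open>A density between 0 and \<open>h\<close> vanishes wherever \<open>h\<close>
    does, so it loses nothing in passing from \<open>M\<close> to \<open>N\<close>.\<close>
  have dens: "density N u = density M u"
    if [measurable]: "u \<in> borel_measurable M" and u: "\<And>x. x \<in> space M \<Longrightarrow> 0 \<le> u x \<and> u x \<le> h x"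
    for u :: "'a \<Rightarrow> real"
  proof -
    have "density N u = density M (\<lambda>x. ennreal (h x) * (ennreal (1 / h x) * ennreal (u x)))"
      unfolding N_def L_def by (simp add: density_density_eq mult.assoc)
    also have "\<dots> = density M u"
    proof (rule density_cong)
      show "AE x in M. ennreal (h x) * (ennreal (1 / h x) * ennreal (u x)) = ennreal (u x)"
      proof (rule AE_I2)
        fix x assume "x \<in> space M"
        then have "0 \<le> u x" "u x \<le> h x" using u by auto
        then show "ennreal (h x) * (ennreal (1 / h x) * ennreal (u x)) = ennreal (u x)"
          by (cases "h x = 0") (simp_all flip: ennreal_mult)
      qed
    qed auto
    finally show ?thesis .
  qed
  show thesis
  proof
    \<comment> \<open>A density with finite values relative to the finite measure \<open>L\<close>
      yields a sigma-finite measure.\<close>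
    show "sigma_finite_measure N"
      unfolding N_def by (subst L.sigma_finite_iff_density_finite) auto
    show "sets N = sets M" by (simp add: N_def)
    show "density N f = density M f" "density N g = density M g"
      using nonneg by (auto intro!: dens simp: h_def)
  qed
qed

text \<open>Rectangles determine the product measure, and the integral over a rectangle factors by
  Tonelli because its indicator is the product of the coordinate indicators.\<close>

lemma PiM_density:
  assumes "finite I" and "product_sigma_finite M" and "product_sigma_finite (\<lambda>i. density (M i) (f i))"
    and [measurable]: "\<And>i. f i \<in> borel_measurable (M i)"
  shows "PiM I (\<lambda>i. density (M i) (f i)) = density (PiM I M) (\<lambda>x. \<Prod>i\<in>I. f i (x i))"
proof -
  interpret M: product_sigma_finite M by fact
  interpret D: product_sigma_finite "\<lambda>i. density (M i) (f i)" by fact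
  have [measurable]: "(\<lambda>x. \<Prod>i\<in>I. f i (x i)) \<in> borel_measurable (PiM I M)"
    by measurable
  show ?thesis
  proof (rule D.PiM_eqI[symmetric])
    show "sets (density (PiM I M) (\<lambda>x. \<Prod>i\<in>I. f i (x i))) = sets (PiM I (\<lambda>i. density (M i) (f i)))"
      by (simp cong: sets_PiM_cong)
    fix A assume "\<And>i. i \<in> I \<Longrightarrow> A i \<in> sets (density (M i) (f i))"
    then have A[measurable]: "\<And>i. i \<in> I \<Longrightarrow> A i \<in> sets (M i)" by simp
    have "emeasure (density (PiM I M) (\<lambda>x. \<Prod>i\<in>I. f i (x i))) (Pi\<^sub>E I A)
        = (\<integral>\<^sup>+x. (\<Prod>i\<in>I. f i (x i)) * indicator (Pi\<^sub>E I A) x \<partial>PiM I M)"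
      using A assms(1) by (intro emeasure_density sets_PiM_I_finite) auto
    also have "\<dots> = (\<integral>\<^sup>+x. (\<Prod>i\<in>I. f i (x i) * indicator (A i) (x i)) \<partial>PiM I M)"
    proof (rule nn_integral_cong)
      fix x assume "x \<in> space (PiM I M)"
      then have "indicator (Pi\<^sub>E I A) x = (\<Prod>i\<in>I. indicator (A i) (x i) :: ennreal)"
        using assms(1) by (auto simp: indicator_def space_PiM PiE_iff intro!: prod_zero)
      then show "(\<Prod>i\<in>I. f i (x i)) * indicator (Pi\<^sub>E I A) x = (\<Prod>i\<in>I. f i (x i) * indicator (A i) (x i))"
        by (simp add: prod.distrib)
    qed
    also have "\<dots> = (\<Prod>i\<in>I. \<integral>\<^sup>+x. f i x * indicator (A i) x \<partial>M i)"
      using assms(1) by (intro M.product_nn_integral_prod) auto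
    also have "\<dots> = (\<Prod>i\<in>I. emeasure (density (M i) (f i)) (A i))"
      by (intro prod.cong refl emeasure_density[symmetric]) auto
    finally show "emeasure (density (PiM I M) (\<lambda>x. \<Prod>i\<in>I. f i (x i))) (Pi\<^sub>E I A)
        = (\<Prod>i\<in>I. emeasure (density (M i) (f i)) (A i))" .
  qed fact
qed

section \<open>Measurability of the loss and of the selector\<close>

lemma measurable_hamming[measurable]:
  "T \<in> measurable M (count_space (cube d)) \<Longrightarrow> (\<lambda>x. hamming d (T x) \<eta>) \<in> borel_measurable M"
  using measurable_compose[of T M "count_space (cube d)" "\<lambda>\<theta>. hamming d \<theta> \<eta>" borel] by simp

lemma integrable_hamming:
  assumes "prob_space M" and [measurable]: "T \<in> measurable M (count_space (cube d))"
  shows "integrable M (\<lambda>x. hamming d (T x) \<eta>)"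
proof -
  interpret prob_space M by fact
  show ?thesis
    by (rule integrable_const_bound[where B = "real d"]) (auto simp: hamming_nonneg hamming_le)
qed

locale pivotal_selection = P0: prob_space P0 + P1: prob_space P1
  for P0 P1 :: "'a measure" +
  fixes \<mu> :: "'a measure" and f0 f1 :: "'a \<Rightarrow> real" and d s :: nat
  assumes s_pos: "1 \<le> s"
    and f0_meas[measurable]: "f0 \<in> borel_measurable \<mu>"
    and f1_meas[measurable]: "f1 \<in> borel_measurable \<mu>"
    and f0_nonneg: "\<And>x. x \<in> space \<mu> \<Longrightarrow> 0 \<le> f0 x"
    and f1_nonneg: "\<And>x. x \<in> space \<mu> \<Longrightarrow> 0 \<le> f1 x"
    and P0_eq: "P0 = density \<mu> (\<lambda>x. ennreal (f0 x))"
    and P1_eq: "P1 = density \<mu> (\<lambda>x. ennreal (f1 x))"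
begin

abbreviation "obs \<eta> \<equiv> obs_law P0 P1 d \<eta>"
text \<open>Only the space and the sigma-algebra of \<open>sample\<close> are used:
  \<open>\<mu>\<close> may fail to be sigma-finite, so integrals are taken against other
  measures.\<close>

abbreviation "sample \<equiv> PiM {1..d} (\<lambda>_. \<mu>)"
abbreviation "star \<equiv> eta_star f0 f1 d s"

lemma prob_space_obs: "prob_space (obs \<eta>)"
  unfolding obs_law_def by (intro prob_space_PiM) (simp add: P0.prob_space_axioms P1.prob_space_axioms)

lemma sets_obs[measurable_cong]: "sets (obs \<eta>) = sets sample"
  unfolding obs_law_def by (rule sets_PiM_cong) (auto simp: P0_eq P1_eq)

text \<open>As \<open>cube d\<close> is finite, preimages of single vectors suffice; each is cut out
  by finitely many inequalities, or their negations, between polynomials in the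
  \<open>f0 (x k)\<close> and \<open>f1 (x k)\<close>.\<close>

lemma measurable_star[measurable]: "star \<in> measurable sample (count_space (cube d))"
proof (subst measurable_count_space_eq2[OF finite_cube], intro conjI ballI)
  show "star \<in> space sample \<rightarrow> cube d"
    using eta_star_in_cube by auto
  fix a assume a: "a \<in> cube d"
  have G: "(\<lambda>x. G_sum f0 f1 d m j x) \<in> borel_measurable sample" for m j
    unfolding G_sum_def
  proof (intro borel_measurable_sum borel_measurable_times borel_measurable_prod)
    fix S k assume "S \<in> {S. S \<subseteq> {1..d} - {j} \<and> card S = m}" "k \<in> S"
    then have [measurable]: "k \<in> {1..d}" by auto
    show "(\<lambda>x. f1 (x k)) \<in> borel_measurable sample" by measurable
  next
    fix S k assume "k \<in> {1..d} - {j} - S"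
    then have [measurable]: "k \<in> {1..d}" by auto
    show "(\<lambda>x. f0 (x k)) \<in> borel_measurable sample" by measurable
  qed
  have "star -` {a} \<inter> space sample = {x\<in>space sample. \<forall>j\<in>{1..d}.
      (f0 (x j) * G_sum f0 f1 d s j x \<le> f1 (x j) * G_sum f0 f1 d (s - 1) j x) = (a j = 1)}"
  proof -
    have "star x = a \<longleftrightarrow> (\<forall>j\<in>{1..d}. star x j = a j)" for x
      using a eta_star_in_cube[of f0 f1 d s x] by (auto simp: cube_def intro: PiE_ext)
    moreover have "star x j = a j \<longleftrightarrow>
        (f0 (x j) * G_sum f0 f1 d s j x \<le> f1 (x j) * G_sum f0 f1 d (s - 1) j x) = (a j = 1)"
      if "j \<in> {1..d}" for x j
      using cube_cases[OF a that] that by (auto simp: eta_star_def)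
    ultimately show ?thesis by auto
  qed
  also have "\<dots> \<in> sets sample"
  proof (rule sets.sets_Collect_finite_All)
    fix j assume [measurable]: "j \<in> {1..d}"
    have "(\<lambda>x. f0 (x j)) \<in> borel_measurable sample" "(\<lambda>x. f1 (x j)) \<in> borel_measurable sample"
      by measurable
    then have "{x\<in>space sample. f0 (x j) * G_sum f0 f1 d s j x \<le> f1 (x j) * G_sum f0 f1 d (s - 1) j x}
        \<in> sets sample"
      by (intro borel_measurable_le borel_measurable_times G)
    from this sets.sets_Collect_neg[OF this]
    show "{x\<in>space sample. (f0 (x j) * G_sum f0 f1 d s j x \<le> f1 (x j) * G_sum f0 f1 d (s - 1) j x)
        = (a j = 1)} \<in> sets sample"
      by (cases "a j = 1") simp_all
  qed simp
  finally show "star -` {a} \<inter> space sample \<in> sets sample" .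
qed

lemma star_in_selectors: "prob_space R \<Longrightarrow> (R, \<lambda>(x, z). star x) \<in> selectors d \<mu>"
  using measurable_compose[OF measurable_fst measurable_star]
  by (simp add: selectors_def case_prod_unfold)

section \<open>Comparison of risks under one reference measure\<close>

text \<open>One \<open>Q\<close> serves every \<open>\<eta>\<close>, which lets a sum of risks under
  different laws become a single integral. It is the product of a sigma-finite substitute for
  \<open>\<mu>\<close>.\<close>

lemma obs_eq_density:
  obtains Q where "sets Q = sets sample"
    and "\<And>\<eta>. obs \<eta> = density Q (\<lambda>x. ennreal (lik f0 f1 d \<eta> x))"
proof -
  obtain N where sf: "sigma_finite_measure N" and setsN[measurable_cong]: "sets N = sets \<mu>"
    and N: "density N f0 = density \<mu> f0" "density N f1 = density \<mu> f1"
  proof (rule sigma_finite_dominating_measure[OF f0_meas f1_meas f0_nonneg f1_nonneg])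
    show "finite_measure (density \<mu> f0)" "finite_measure (density \<mu> f1)"
      using P0.finite_measure_axioms P1.finite_measure_axioms by (simp_all add: P0_eq P1_eq)
  qed blast
  have spN: "space N = space \<mu>"
    using setsN by (rule sets_eq_imp_space_eq)
  show thesis
  proof
    show "sets (PiM {1..d} (\<lambda>_. N)) = sets sample"
      by (rule sets_PiM_cong) (auto simp: setsN)
    fix \<eta> :: "nat \<Rightarrow> nat"
    define g where "g k = (\<lambda>x. ennreal (if \<eta> k = 1 then f1 x else f0 x))" for k
    have P: "(if \<eta> k = 1 then P1 else P0) = density N (g k)" for k
      by (simp add: P0_eq P1_eq N g_def)
    have "obs \<eta> = PiM {1..d} (\<lambda>k. density N (g k))"
      unfolding obs_law_def P ..
    also have "\<dots> = density (PiM {1..d} (\<lambda>_. N)) (\<lambda>x. \<Prod>k\<in>{1..d}. g k (x k))"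
    proof (rule PiM_density)
      show "product_sigma_finite (\<lambda>_. N)"
        using sf by (simp add: product_sigma_finite_def)
      \<comment> \<open>Each factor is again \<open>P0\<close> or \<open>P1\<close>, hence a
        probability measure.\<close>
      show "product_sigma_finite (\<lambda>k. density N (g k))"
        by (simp add: product_sigma_finite_def flip: P)
          (simp add: P0.sigma_finite_measure_axioms P1.sigma_finite_measure_axioms)
      show "g k \<in> borel_measurable N" for k
        unfolding g_def by measurable
    qed simp
    also have "\<dots> = density (PiM {1..d} (\<lambda>_. N)) (\<lambda>x. ennreal (lik f0 f1 d \<eta> x))"
    proof (rule density_cong)
      show "AE x in PiM {1..d} (\<lambda>_. N). (\<Prod>k\<in>{1..d}. g k (x k)) = ennreal (lik f0 f1 d \<eta> x)"
      proof (rule AE_I2)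
        fix x assume "x \<in> space (PiM {1..d} (\<lambda>_. N))"
        then have "x k \<in> space \<mu>" if "k \<in> {1..d}" for k
          using that by (auto simp: space_PiM spN)
        then show "(\<Prod>k\<in>{1..d}. g k (x k)) = ennreal (lik f0 f1 d \<eta> x)"
          unfolding lik_def g_def by (intro prod_ennreal) (auto simp: f0_nonneg f1_nonneg)
      qed
    qed (auto simp: lik_def g_def)
    finally show "obs \<eta> = density (PiM {1..d} (\<lambda>_. N)) (\<lambda>x. ennreal (lik f0 f1 d \<eta> x))" .
  qed
qed

lemma lik_nonneg: "x \<in> space sample \<Longrightarrow> 0 \<le> lik f0 f1 d \<eta> x"
  unfolding lik_def by (rule prod_nonneg) (auto simp: space_PiM PiE_iff f0_nonneg f1_nonneg)

text \<open>The summed risk is the integral over \<open>Q\<close> of the likelihood-weighted loss,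
  and \<open>eta_star_minimises\<close> compares the integrands at every sample point.\<close>

lemma sum_risk_nr_star_le:
  assumes t[measurable]: "t \<in> measurable sample (count_space (cube d))"
  shows "(\<Sum>\<eta>\<in>sparse_vecs d s. risk_nr P0 P1 d star \<eta>) \<le> (\<Sum>\<eta>\<in>sparse_vecs d s. risk_nr P0 P1 d t \<eta>)"
proof -
  obtain Q where Q[measurable_cong]: "sets Q = sets sample"
    and obs: "\<And>\<eta>. obs \<eta> = density Q (\<lambda>x. ennreal (lik f0 f1 d \<eta> x))"
    by (rule obs_eq_density) blast
  have spQ: "space Q = space sample"
    using Q by (rule sets_eq_imp_space_eq)
  have [measurable]: "lik f0 f1 d \<eta> \<in> borel_measurable Q" for \<eta>
    unfolding lik_def by measurable
  have nonneg: "AE x in Q. 0 \<le> lik f0 f1 d \<eta> x" for \<eta>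
    by (rule AE_I2) (simp add: lik_nonneg spQ)
  have int: "integrable Q (\<lambda>x. lik f0 f1 d \<eta> x * hamming d (u x) \<eta>)"
    and risk: "risk_nr P0 P1 d u \<eta> = (\<integral>x. lik f0 f1 d \<eta> x * hamming d (u x) \<eta> \<partial>Q)"
    if [measurable]: "u \<in> measurable sample (count_space (cube d))" for u \<eta>
  proof -
    have m: "(\<lambda>x. hamming d (u x) \<eta>) \<in> borel_measurable Q"
      by measurable
    \<comment> \<open>\<open>Q\<close> need not be finite, so integrability is obtained from the
      bounded loss under the probability law \<open>obs \<eta>\<close> and transferred through the
      density.\<close>
    have "integrable (obs \<eta>) (\<lambda>x. hamming d (u x) \<eta>)"
      by (rule integrable_hamming[OF prob_space_obs]) measurable
    then show "integrable Q (\<lambda>x. lik f0 f1 d \<eta> x * hamming d (u x) \<eta>)"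
      unfolding obs by (subst (asm) integrable_density[OF m _ nonneg]) auto
    show "risk_nr P0 P1 d u \<eta> = (\<integral>x. lik f0 f1 d \<eta> x * hamming d (u x) \<eta> \<partial>Q)"
      unfolding risk_nr_def obs by (subst integral_density[OF m _ nonneg]) auto
  qed
  have tin: "t x \<in> cube d" if "x \<in> space Q" for x
    using measurable_space[OF t] that by (simp add: spQ)
  show ?thesis
    unfolding risk[OF measurable_star] risk[OF t]
      Bochner_Integration.integral_sum[OF int[OF measurable_star], symmetric]
      Bochner_Integration.integral_sum[OF int[OF t], symmetric]
    by (intro integral_mono Bochner_Integration.integrable_sum int t measurable_star
        eta_star_minimises s_pos tin)
qed

text \<open>Fubini for the bounded loss: conditioning on the randomization variable reduces the risk
  to risks of non-randomized selectors.\<close>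

lemma risk_eq:
  assumes "(R, T) \<in> selectors d \<mu>"
  shows "risk P0 P1 d R T \<eta> = (\<integral>z. risk_nr P0 P1 d (\<lambda>x. T (x, z)) \<eta> \<partial>R)"
    and "integrable R (\<lambda>z. risk_nr P0 P1 d (\<lambda>x. T (x, z)) \<eta>)"
proof -
  have R: "prob_space R" and T[measurable]: "T \<in> measurable (sample \<Otimes>\<^sub>M R) (count_space (cube d))"
    using assms by (auto simp: selectors_def)
  interpret R: prob_space R by fact
  interpret O: prob_space "obs \<eta>" by (rule prob_space_obs)
  interpret OR: pair_prob_space "obs \<eta>" R ..
  have "integrable (obs \<eta> \<Otimes>\<^sub>M R) (\<lambda>\<omega>. hamming d (T \<omega>) \<eta>)"
    by (rule integrable_hamming[OF OR.prob_space_axioms]) measurable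
  then have int: "integrable (obs \<eta> \<Otimes>\<^sub>M R) (\<lambda>(x, z). hamming d (T (x, z)) \<eta>)"
    by (simp add: case_prod_unfold)
  show "risk P0 P1 d R T \<eta> = (\<integral>z. risk_nr P0 P1 d (\<lambda>x. T (x, z)) \<eta> \<partial>R)"
    using OR.integral_snd[OF int] by (simp add: risk_def risk_nr_def case_prod_unfold)
  show "integrable R (\<lambda>z. risk_nr P0 P1 d (\<lambda>x. T (x, z)) \<eta>)"
    using OR.integrable_snd[OF int] by (simp add: risk_nr_def)
qed

lemma risk_star: "prob_space R \<Longrightarrow> risk P0 P1 d R (\<lambda>(x, z). star x) \<eta> = risk_nr P0 P1 d star \<eta>"
  by (subst risk_eq(1)[OF star_in_selectors]) (simp_all add: prob_space.prob_space)

text \<open>Randomization cannot help: for each \<open>z\<close>, \<open>sum_risk_nr_star_le\<close>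
  applies to the selector with \<open>z\<close> fixed, and averaging over the probability measure
  \<open>R\<close> preserves a lower bound that does not depend on \<open>z\<close>.\<close>

lemma sum_risk_ge:
  assumes sel: "(R, T) \<in> selectors d \<mu>"
  shows "(\<Sum>\<eta>\<in>sparse_vecs d s. risk_nr P0 P1 d star \<eta>) \<le> (\<Sum>\<eta>\<in>sparse_vecs d s. risk P0 P1 d R T \<eta>)"
proof -
  have R: "prob_space R" and T[measurable]: "T \<in> measurable (sample \<Otimes>\<^sub>M R) (count_space (cube d))"
    using sel by (auto simp: selectors_def)
  interpret R: prob_space R by fact
  have "(\<Sum>\<eta>\<in>sparse_vecs d s. risk_nr P0 P1 d star \<eta>)
      \<le> (\<integral>z. (\<Sum>\<eta>\<in>sparse_vecs d s. risk_nr P0 P1 d (\<lambda>x. T (x, z)) \<eta>) \<partial>R)"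
    by (intro R.integral_ge_const Bochner_Integration.integrable_sum risk_eq(2)[OF sel] AE_I2
        sum_risk_nr_star_le) measurable
  also have "\<dots> = (\<Sum>\<eta>\<in>sparse_vecs d s. risk P0 P1 d R T \<eta>)"
    by (simp add: Bochner_Integration.integral_sum risk_eq[OF sel])
  finally show ?thesis .
qed

section \<open>Constant risk over the sparse vectors\<close>

text \<open>Permuting the sample by a suitable \<open>p\<close> carries \<open>obs \<eta>\<close> to
  \<open>obs \<theta>\<close>, while the loss of \<open>star\<close> is unchanged when data and
  parameter are permuted together.\<close>

lemma risk_nr_star_const:
  assumes \<eta>: "\<eta> \<in> sparse_vecs d s" and \<theta>: "\<theta> \<in> sparse_vecs d s"
  shows "risk_nr P0 P1 d star \<theta> = risk_nr P0 P1 d star \<eta>"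
proof -
  obtain p where p: "bij_betw p {1..d} {1..d}" and \<theta>_eq: "\<And>j. j \<in> {1..d} \<Longrightarrow> \<theta> j = \<eta> (p j)"
    using sparse_vecs_permutation[OF \<eta> \<theta>] by blast
  let ?perm = "\<lambda>x. \<lambda>n\<in>{1..d}. x (p n)"
  \<comment> \<open>Written through \<open>\<eta> (p j)\<close>, the target law has the reindexed
    form that \<open>distr_PiM_reindex\<close> produces.\<close>
  have obs_\<theta>: "obs \<theta> = PiM {1..d} (\<lambda>j. if \<eta> (p j) = 1 then P1 else P0)"
    unfolding obs_law_def by (rule PiM_cong) (auto simp: \<theta>_eq)
  have "distr (obs \<eta>) (obs \<theta>) ?perm = obs \<theta>"
    unfolding obs_\<theta> unfolding obs_law_def
    using p by (intro distr_PiM_reindex)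
      (auto simp: bij_betw_def P0.prob_space_axioms P1.prob_space_axioms)
  moreover have perm[measurable]: "?perm \<in> measurable (obs \<eta>) (obs \<theta>)"
    unfolding measurable_cong_sets[OF sets_obs sets_obs]
    by (intro measurable_restrict measurable_component_singleton) (use bij_betwE[OF p] in blast)
  ultimately have "risk_nr P0 P1 d star \<theta> = (\<integral>x. hamming d (star (?perm x)) \<theta> \<partial>obs \<eta>)"
    unfolding risk_nr_def by (subst integral_distr[OF perm, symmetric]) simp_all
  also have "\<dots> = risk_nr P0 P1 d star \<eta>"
    unfolding risk_nr_def by (simp only: hamming_eta_star_permute[OF p, of \<theta> \<eta>, OF \<theta>_eq])
  finally show ?thesis .
qed

end

section \<open>From Bayes with constant risk to minimax\<close>

text \<open>A real infimum is meaningful only for a nonempty set bounded below; an attained lower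
  bound supplies both.\<close>

lemma cINF_eq_attained:
  fixes F :: "'b \<Rightarrow> real"
  assumes "a \<in> A" and "F a = v" and "\<And>b. b \<in> A \<Longrightarrow> v \<le> F b"
  shows "(INF b\<in>A. F b) = v"
  using assms by (intro cInf_eq_minimum) auto

theorem theorem3:
  fixes P0 P1 \<mu> :: "'a measure" and f0 f1 :: "'a \<Rightarrow> real" and d s :: nat
  assumes "d > 2" and "2 \<le> s" and "s < d"
    and "prob_space P0" and "prob_space P1" and "P0 \<noteq> P1"
    and "f0 \<in> borel_measurable \<mu>" and "f1 \<in> borel_measurable \<mu>"
    and "\<And>x. x \<in> space \<mu> \<Longrightarrow> f0 x \<ge> 0" and "\<And>x. x \<in> space \<mu> \<Longrightarrow> f1 x \<ge> 0"
    and "P0 = density \<mu> (\<lambda>x. ennreal (f0 x))" and "P1 = density \<mu> (\<lambda>x. ennreal (f1 x))"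
  shows "(\<forall>R :: 'z measure. prob_space R \<longrightarrow>
            (R, \<lambda>(x, z). eta_star f0 f1 d s x) \<in> selectors d \<mu>) \<and>
         (INF (R :: 'z measure, T) \<in> selectors d \<mu>. SUP \<eta>\<in>sparse_vecs d s. risk P0 P1 d R T \<eta>)
            = (SUP \<eta>\<in>sparse_vecs d s. risk_nr P0 P1 d (eta_star f0 f1 d s) \<eta>) \<and>
         (SUP \<eta>\<in>sparse_vecs d s. risk_nr P0 P1 d (eta_star f0 f1 d s) \<eta>)
            = risk_nr P0 P1 d (eta_star f0 f1 d s) (e_vec d s) \<and>
         (INF (R :: 'z measure, T) \<in> selectors d \<mu>.
            measure_pmf.expectation (pmf_of_set (sparse_vecs d s)) (\<lambda>\<eta>. risk P0 P1 d R T \<eta>))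
            = measure_pmf.expectation (pmf_of_set (sparse_vecs d s))
                (\<lambda>\<eta>. risk_nr P0 P1 d (eta_star f0 f1 d s) \<eta>) \<and>
         measure_pmf.expectation (pmf_of_set (sparse_vecs d s))
                (\<lambda>\<eta>. risk_nr P0 P1 d (eta_star f0 f1 d s) \<eta>)
            = risk_nr P0 P1 d (eta_star f0 f1 d s) (e_vec d s)"
proof -
  let ?e = "e_vec d s" and ?star = "eta_star f0 f1 d s" and ?A = "sparse_vecs d s"
  interpret prob_space P0 by fact
  interpret P1: prob_space P1 by fact
  interpret pivotal_selection P0 P1 \<mu> f0 f1 d s
    using assms by unfold_locales auto
  \<comment> \<open>The constant risk of \<open>eta_star\<close>, to which every side of the claimed
    equations reduces.\<close>
  define v where "v = risk_nr P0 P1 d ?star ?e"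
  have e: "?e \<in> ?A"
    using \<open>s < d\<close> by (simp add: e_vec_in_sparse_vecs)
  then have ne: "?A \<noteq> {}" by auto
  then have card: "0 < real (card ?A)"
    by (simp add: card_gt_0_iff finite_sparse_vecs)
  have const: "risk_nr P0 P1 d ?star \<eta> = v" if "\<eta> \<in> ?A" for \<eta>
    unfolding v_def by (rule risk_nr_star_const[OF e that])
  have avg: "measure_pmf.expectation (pmf_of_set ?A) F = (\<Sum>\<eta>\<in>?A. F \<eta>) / card ?A" for F :: "_ \<Rightarrow> real"
    by (rule integral_pmf_of_set[OF ne finite_sparse_vecs])
  have sup: "(SUP \<eta>\<in>?A. F \<eta>) = v" if "\<And>\<eta>. \<eta> \<in> ?A \<Longrightarrow> F \<eta> = v" for F
    using that ne by (simp cong: SUP_cong)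
  have exp: "measure_pmf.expectation (pmf_of_set ?A) F = v" if "\<And>\<eta>. \<eta> \<in> ?A \<Longrightarrow> F \<eta> = v" for F
    using that card by (simp add: avg)
  \<comment> \<open>Dividing \<open>sum_risk_ge\<close> by the number of sparse vectors turns sums
    into prior averages; constant risk makes the left average \<open>v\<close>.\<close>
  have bayes: "v \<le> measure_pmf.expectation (pmf_of_set ?A) (risk P0 P1 d R T)"
    if "(R, T) \<in> selectors d \<mu>" for R :: "'z measure" and T
    using sum_risk_ge[OF that] card by (simp add: avg const field_simps)
  \<comment> \<open>The maximum over a finite set is at least the average, which
    \<open>bayes\<close> bounds below by \<open>v\<close>.\<close>
  have minimax: "v \<le> (SUP \<eta>\<in>?A. risk P0 P1 d R T \<eta>)"
    if "(R, T) \<in> selectors d \<mu>" for R :: "'z measure" and T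
  proof -
    have "(\<Sum>\<eta>\<in>?A. risk P0 P1 d R T \<eta>) \<le> card ?A * (SUP \<eta>\<in>?A. risk P0 P1 d R T \<eta>)"
      by (intro sum_bounded_above cSUP_upper bdd_above_finite finite_imageI finite_sparse_vecs)
    then have "measure_pmf.expectation (pmf_of_set ?A) (risk P0 P1 d R T)
        \<le> (SUP \<eta>\<in>?A. risk P0 P1 d R T \<eta>)"
      using card by (simp add: avg field_simps)
    then show ?thesis
      using bayes[OF that] by simp
  qed
  \<comment> \<open>For the infimum to be attained, \<open>eta_star\<close> must be paired with some
    probability measure on \<open>'z\<close>; a point mass exists on every type.\<close>
  define R0 :: "'z measure" where "R0 = return (count_space UNIV) undefined"
  have R0: "prob_space R0"
    unfolding R0_def by (rule prob_space_return) simp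
  have a0: "(R0, \<lambda>(x, z). ?star x) \<in> selectors d \<mu>"
    by (rule star_in_selectors[OF R0])
  have "(INF (R :: 'z measure, T) \<in> selectors d \<mu>. SUP \<eta>\<in>?A. risk P0 P1 d R T \<eta>) = v"
    by (rule cINF_eq_attained[OF a0]) (auto simp: risk_star[OF R0] const intro!: sup minimax)
  moreover have "(INF (R :: 'z measure, T) \<in> selectors d \<mu>.
      measure_pmf.expectation (pmf_of_set ?A) (\<lambda>\<eta>. risk P0 P1 d R T \<eta>)) = v"
    by (rule cINF_eq_attained[OF a0]) (auto simp: risk_star[OF R0] const intro!: exp bayes)
  ultimately show ?thesis
    using star_in_selectors sup[of "risk_nr P0 P1 d ?star", OF const]
      exp[of "risk_nr P0 P1 d ?star", OF const] by (auto simp: v_def)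
qed

end
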